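(* For every integer $k\in\mathbb{Z}$ and every integer $n\geq 1$, $$B_{n}^{(k)}(x)=xB_{n-1}^{(k)}(x)+\sum_{l=0}^{n-1}(-1)^{n-1-l}\binom{n-1}{l}\left\{\sum_{m=0}^{n-1}(-1)^{m}\frac{(m+1)!}{(m+2)^{k}}S_{2}(n-1-l,m)\right\}(x-1)^{l}.$$
   Context: For $k\in\mathbb{Z}$, the polylogarithm is $Li_k(x)=\sum_{m=1}^{\infty}\frac{x^m}{m^k}$. The poly-Bernoulli polynomials $B_n^{(k)}(x)$ are defined by the generating function (an identity of formal power series in $t$) $$\frac{Li_{k}(1-e^{-t})}{1-e^{-t}}e^{xt}=\sum_{n=0}^{\infty}B_{n}^{(k)}(x)\frac{t^{n}}{n!}.$$ $S_2(l,m)$ denotes the Stirling numbers of the second kind, defined by $(e^t-1)^m=m!\sum_{l=m}^\infty S_2(l,m)\frac{t^l}{l!}$ (with $S_2(l,m)=0$ for $l<m$). *)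

theory Defs
  imports
    "HOL-Computational_Algebra.Computational_Algebra"
    "HOL-Combinatorics.Stirling"
begin

definition fps_polylog :: "int \<Rightarrow> 'a :: field_char_0 fps" where
  "fps_polylog k = Abs_fps (\<lambda>m. if m = 0 then 0 else 1 / of_nat m powi k)"

text \<open>
  Both the numerator and the denominator have zero constant term. The division of formal power
  series over a field cancels the common power of the variable, so this is the exact quotient;
  see \<open>poly_bernoulli_quotient_fps_exact\<close>.
\<close>
definition poly_bernoulli_quotient_fps :: "int \<Rightarrow> 'a :: field_char_0 fps" where
  "poly_bernoulli_quotient_fps k =
     fps_compose (fps_polylog k) (1 - fps_exp (-1)) / (1 - fps_exp (-1))"

lemma poly_bernoulli_quotient_fps_exact:
  "poly_bernoulli_quotient_fps k * (1 - fps_exp (-1)) =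
     fps_compose (fps_polylog k) (1 - fps_exp (-1 :: 'a :: field_char_0))"
proof -
  let ?u = "1 - fps_exp (-1) :: 'a fps"
  have u1: "?u $ 1 \<noteq> 0" by simp
  have sub: "subdegree ?u = 1"
    by (rule subdegreeI) auto
  have "?u dvd fps_compose (fps_polylog k) ?u"
  proof (cases "fps_compose (fps_polylog k) ?u = 0")
    case False
    have "(fps_compose (fps_polylog k) ?u) $ 0 = (0 :: 'a)"
      by (simp add: fps_polylog_def)
    with False have "subdegree (fps_compose (fps_polylog k) ?u) \<ge> 1"
      by (metis One_nat_def Suc_leI gr0I nth_subdegree_zero_iff)
    moreover have "?u \<noteq> 0" using u1 by force
    ultimately show ?thesis
      using False sub by (simp add: fps_dvd_iff)
  qed auto
  then show ?thesis
    by (simp add: poly_bernoulli_quotient_fps_def)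
qed

text \<open>
  The generating function has coefficients in the polynomial ring. The left factor is the
  quotient series with its coefficients viewed as constant polynomials, and the right factor is
  \<open>e\<^sup>x\<^sup>t = (\<Sum>n. x\<^sup>n / n! * t\<^sup>n)\<close> with \<open>x\<close> the indeterminate of the polynomial ring.
\<close>
definition poly_bernoulli_fps :: "int \<Rightarrow> 'a :: field_char_0 poly fps" where
  "poly_bernoulli_fps k =
     Abs_fps (\<lambda>n. [:poly_bernoulli_quotient_fps k $ n:]) * Abs_fps (\<lambda>n. monom (1 / fact n) n)"

definition poly_bernoulli :: "int \<Rightarrow> nat \<Rightarrow> 'a :: field_char_0 poly" where
  "poly_bernoulli k n = smult (fact n) (poly_bernoulli_fps k $ n)"

lemma poly_bernoulli_generating_function:
  fixes x :: "'a :: field_char_0"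
  shows "poly_bernoulli_quotient_fps k * fps_exp x =
           Abs_fps (\<lambda>n. poly (poly_bernoulli k n) x / fact n)"
  by (rule fps_ext)
     (simp add: poly_bernoulli_def poly_bernoulli_fps_def fps_mult_nth poly_sum poly_monom)

text \<open>
  \<^const>\<open>Stirling\<close> is defined by recursion in the library. The following is the usual definition
  of the Stirling numbers of the second kind by their exponential generating function.
\<close>
lemma Stirling_generating_function:
  "(fps_exp 1 - 1) ^ m =
     fps_const (fact m) * Abs_fps (\<lambda>l. of_nat (Stirling l m) / fact l :: 'a :: field_char_0)"
proof -
  let ?F = "\<lambda>m. (fps_exp 1 - 1 :: 'a fps) ^ m"
  have "fact l * ?F m $ l = fact m * of_nat (Stirling l m)" for l m
  proof (induction l m rule: Stirling.induct)
    case (4 l m)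
    have "fps_deriv (?F (Suc m)) = of_nat (Suc m) * (?F m * fps_exp 1)"
      by (simp add: fps_deriv_power' algebra_simps del: power_Suc of_nat_Suc)
    also have "?F m * fps_exp 1 = ?F (Suc m) + ?F m"
      by (simp add: algebra_simps)
    finally have "fps_deriv (?F (Suc m)) $ l = (of_nat (Suc m) * (?F (Suc m) + ?F m)) $ l"
      by simp
    then have "of_nat (Suc l) * ?F (Suc m) $ Suc l = of_nat (Suc m) * (?F (Suc m) $ l + ?F m $ l)"
      by (simp add: fps_of_nat [symmetric] del: power_Suc of_nat_Suc)
    then have "fact (Suc l) * ?F (Suc m) $ Suc l =
                 of_nat (Suc m) * (fact l * ?F (Suc m) $ l + fact l * ?F m $ l)"
      by (simp add: algebra_simps del: power_Suc of_nat_Suc)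
    also have "\<dots> = of_nat (Suc m) *
        (fact (Suc m) * of_nat (Stirling l (Suc m)) + fact m * of_nat (Stirling l m))"
      using 4 by simp
    also have "\<dots> = fact (Suc m) * of_nat (Stirling (Suc l) (Suc m))"
      by (simp add: algebra_simps)
    finally show ?case .
  qed auto
  then show ?thesis
    by (intro fps_ext) (simp add: field_simps)
qed

end

theory Submission
  imports Defs
begin

text \<open>
  With \<open>u = 1 - e\<^sup>-\<^sup>t\<close>, the quotient is \<open>Q = A(u)\<close> for \<open>A = (\<Sum>m. X\<^sup>m / (m + 1)\<^sup>k)\<close>. Since
  \<open>u' = e\<^sup>-\<^sup>t\<close>, the generating function \<open>G = Q e\<^sup>x\<^sup>t\<close> satisfies \<open>G' = x G + A'(u) e\<^sup>(\<^sup>x\<^sup>-\<^sup>1\<^sup>)\<^sup>t\<close>.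
  The powers of \<open>u\<close> in \<open>A'(u)\<close> expand in Stirling numbers, and comparing coefficients of
  \<open>t\<^sup>n\<^sup>-\<^sup>1\<close> gives the recurrence.
\<close>

definition fps_polylog_quotient :: "int \<Rightarrow> 'a :: field_char_0 fps" where
  "fps_polylog_quotient k = Abs_fps (\<lambda>m. 1 / of_nat (Suc m) powi k)"

lemma fps_polylog_eq_quotient_times_X:
  "fps_polylog k = fps_polylog_quotient k * fps_X"
  by (rule fps_ext) (simp add: fps_polylog_def fps_polylog_quotient_def)

text \<open>Multiplied by the nonzero series \<open>1 - fps_exp (-1)\<close>, both sides become the
  composed polylogarithm; cancel in an integral domain.\<close>

lemma poly_bernoulli_quotient_fps_eq_compose:
  "poly_bernoulli_quotient_fps k =
     fps_polylog_quotient k oo (1 - fps_exp (-1 :: 'a :: field_char_0))"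
proof -
  let ?u = "1 - fps_exp (-1) :: 'a fps"
  have "?u $ 1 \<noteq> 0" by simp
  then have "?u \<noteq> 0" by force
  moreover have "poly_bernoulli_quotient_fps k * ?u = (fps_polylog_quotient k oo ?u) * ?u"
    unfolding poly_bernoulli_quotient_fps_exact fps_polylog_eq_quotient_times_X
    by (simp add: fps_compose_mult_distrib)
  ultimately show ?thesis by simp
qed

text \<open>Putting \<open>-t\<close> for \<open>t\<close> in \<open>e^t - 1\<close> gives
  \<open>-(1 - e^(-t))\<close>: the power contributes \<open>(-1) ^ m\<close>, the substitution
  \<open>(-1) ^ j\<close>.\<close>

lemma power_one_minus_fps_exp_nth:
  "((1 - fps_exp (-1)) ^ m :: 'a :: field_char_0 fps) $ j =
     (-1) ^ j * (-1) ^ m * fact m * of_nat (Stirling j m) / fact j"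
proof -
  let ?X = "fps_const (-1) * fps_X :: 'a fps"
  have "(1 - fps_exp (-1) :: 'a fps) = fps_const (-1) * ((fps_exp 1 - 1) oo ?X)"
    by (rule fps_ext) (simp add: fps_compose_sub_distrib fps_exp_compose_linear del: fps_const_neg)
  then have "(1 - fps_exp (-1)) ^ m = fps_const ((-1) ^ m) * ((fps_exp 1 - 1) ^ m oo ?X)"
    by (simp add: power_mult_distrib fps_const_power fps_compose_power del: fps_const_neg)
  then show ?thesis
    unfolding Stirling_generating_function
    by (simp del: fps_const_neg)
qed

text \<open>Differentiation supplies the factor \<open>m + 1\<close> that turns
  \<open>fact m\<close> into \<open>fact (m + 1)\<close>. A bound \<open>N\<close> independent of
  \<open>j\<close> gives all coefficients of the later Cauchy product the same inner range.\<close>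

lemma deriv_polylog_quotient_compose_nth:
  assumes "j \<le> N"
  shows "(fps_deriv (fps_polylog_quotient k) oo (1 - fps_exp (-1 :: 'a :: field_char_0))) $ j =
           (-1) ^ j / fact j *
           (\<Sum>m=0..N. (-1) ^ m * (fact (m + 1) / of_nat (m + 2) powi k) * of_nat (Stirling j m))"
proof -
  let ?c = "\<lambda>m. (-1) ^ j / fact j *
    ((-1) ^ m * (fact (m + 1) / of_nat (m + 2) powi k) * of_nat (Stirling j m)) :: 'a"
  have "(fps_deriv (fps_polylog_quotient k) oo (1 - fps_exp (-1 :: 'a))) $ j = (\<Sum>m=0..j. ?c m)"
    unfolding fps_compose_nth
    by (intro sum.cong refl)
       (simp add: fps_polylog_quotient_def power_one_minus_fps_exp_nth algebra_simps
         add_divide_distrib)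
  \<comment> \<open>The added terms vanish, since \<open>Stirling j m = 0\<close> for
    \<open>m > j\<close>.\<close>
  also have "\<dots> = (\<Sum>m=0..N. ?c m)"
    using assms by (intro sum.mono_neutral_left) auto
  finally show ?thesis by (simp add: sum_distrib_left)
qed

lemma fps_deriv_poly_bernoulli_generating_function:
  fixes k :: int and x :: "'a :: field_char_0"
  defines "G \<equiv> poly_bernoulli_quotient_fps k * fps_exp x"
  shows "fps_deriv G = fps_const x * G +
           fps_exp (x - 1) * (fps_deriv (fps_polylog_quotient k) oo (1 - fps_exp (-1)))"
proof -
  have "fps_deriv (poly_bernoulli_quotient_fps k) =
          (fps_deriv (fps_polylog_quotient k) oo (1 - fps_exp (-1))) * fps_exp (-1 :: 'a)"
    by (simp add: poly_bernoulli_quotient_fps_eq_compose fps_compose_deriv flip: fps_const_neg)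
  moreover have "fps_exp (x - 1) = fps_exp (-1) * fps_exp x"
    by (simp flip: fps_exp_add_mult)
  ultimately show ?thesis
    by (simp add: G_def algebra_simps)
qed

theorem theorem3:
  fixes k :: int and n :: nat and x :: "'a :: field_char_0"
  assumes "n \<ge> 1"
  shows "poly (poly_bernoulli k n) x =
           x * poly (poly_bernoulli k (n - 1)) x +
           (\<Sum>l=0..n-1. (-1) ^ (n - 1 - l) * of_nat ((n - 1) choose l) *
              (\<Sum>m=0..n-1. (-1) ^ m * (fact (m + 1) / of_nat (m + 2) powi k) *
                 of_nat (Stirling (n - 1 - l) m)) * (x - 1) ^ l)"
proof -
  obtain N where n: "n = Suc N" using assms by (cases n) auto
  let ?B = "\<lambda>n. poly (poly_bernoulli k n) x"
  let ?S = "\<lambda>j. \<Sum>m=0..N. (-1) ^ m * (fact (m + 1) / of_nat (m + 2) powi k) *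
    of_nat (Stirling j m) :: 'a"
  let ?D = "fps_deriv (fps_polylog_quotient k) oo (1 - fps_exp (-1 :: 'a))"
  have "fps_deriv (Abs_fps (\<lambda>n. ?B n / fact n)) $ N =
          (fps_const x * Abs_fps (\<lambda>n. ?B n / fact n) + fps_exp (x - 1) * ?D) $ N"
    using fps_deriv_poly_bernoulli_generating_function[of k x]
    by (simp only: poly_bernoulli_generating_function)
  \<comment> \<open>The factor \<open>Suc N\<close> from differentiation reduces
    \<open>fact (Suc N)\<close> to \<open>fact N\<close>.\<close>
  then have "?B (Suc N) / fact N = x * ?B N / fact N + (fps_exp (x - 1) * ?D) $ N"
    by (simp add: field_simps del: of_nat_Suc)
  then have "?B (Suc N) = x * ?B N + fact N * (fps_exp (x - 1) * ?D) $ N"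
    by (simp add: field_simps)
  \<comment> \<open>In the Cauchy product, the denominators \<open>fact l\<close> and
    \<open>fact (N - l)\<close> combine with \<open>fact N\<close> into the binomial
    coefficient.\<close>
  also have "fact N * (fps_exp (x - 1) * ?D) $ N =
      (\<Sum>l=0..N. (-1) ^ (N - l) * of_nat (N choose l) * ?S (N - l) * (x - 1) ^ l)"
    unfolding fps_mult_nth sum_distrib_left[of "fact N"]
  proof (intro sum.cong refl)
    fix l assume "l \<in> {0..N}"
    then have "of_nat (N choose l) = (fact N / (fact l * fact (N - l)) :: 'a)"
      by (simp add: binomial_fact)
    moreover have "?D $ (N - l) = (-1) ^ (N - l) / fact (N - l) * ?S (N - l)"
      by (rule deriv_polylog_quotient_compose_nth) simp
    ultimately show "fact N * (fps_exp (x - 1) $ l * ?D $ (N - l)) =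
        (-1) ^ (N - l) * of_nat (N choose l) * ?S (N - l) * (x - 1) ^ l"
      by (simp only: fps_exp_nth) (simp add: field_simps)
  qed
  finally show ?thesis by (simp add: n)
qed

end
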